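(* Let $G$ be a forest on $n$ vertices with no isolated vertices. Then $\operatorname{avd}(G)\leq \frac{2n}{3}$. Moreover, equality holds if and only if every non-leaf vertex of $G$ is a support vertex with one or two leaf neighbors.
   Context: All graphs are finite, simple and undirected. A set $S\subseteq V(G)$ is a dominating set of $G$ if every vertex of $V(G)\setminus S$ is adjacent to some vertex of $S$. Let $\mathcal{D}(G)$ be the family of all dominating sets of $G$. The average order of a dominating set of $G$ is $\operatorname{avd}(G)=\frac{\sum_{S\in\mathcal{D}(G)}|S|}{|\mathcal{D}(G)|}$. A leaf is a vertex of degree one; a support vertex is a vertex adjacent to at least one leaf; the leaf neighbors of a vertex are the leaves adjacent to it. *)

theory Defs
  imports Complex_Main "Graph_Theory.Pair_Digraph"
begin

text \<open>
  A finite simple undirected graph is a \<open>pair_graph\<close>: a finite, symmetric, loop-free relation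
  \<open>parcs G\<close> on the vertex set \<open>pverts G\<close>. An undirected edge is a pair of opposite arcs, so the
  degree of a vertex is its out-degree.
\<close>

text \<open>
  In a symmetric digraph every edge traversed back and forth is a directed cycle of length two, so
  the library's \<open>forest\<close> would only hold for edgeless graphs. The cycles of the undirected graph are
  the directed cycles of length at least three.
\<close>

definition undirected_forest :: "'a pair_pre_digraph \<Rightarrow> bool" where
  "undirected_forest G \<longleftrightarrow> pair_graph G \<and> \<not> (\<exists>p. pre_digraph.cycle G p \<and> 3 \<le> length p)"

definition isolated_vertex :: "'a pair_pre_digraph \<Rightarrow> 'a \<Rightarrow> bool" where
  "isolated_vertex G v \<longleftrightarrow> v \<in> pverts G \<and> out_degree G v = 0"

definition leaf :: "'a pair_pre_digraph \<Rightarrow> 'a \<Rightarrow> bool" where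
  "leaf G v \<longleftrightarrow> v \<in> pverts G \<and> out_degree G v = 1"

definition leaf_neighbors :: "'a pair_pre_digraph \<Rightarrow> 'a \<Rightarrow> 'a set" where
  "leaf_neighbors G v = {u. leaf G u \<and> (v, u) \<in> parcs G}"

definition support_vertex :: "'a pair_pre_digraph \<Rightarrow> 'a \<Rightarrow> bool" where
  "support_vertex G v \<longleftrightarrow> v \<in> pverts G \<and> (\<exists>u. leaf G u \<and> (v, u) \<in> parcs G)"

definition dominating_set :: "'a pair_pre_digraph \<Rightarrow> 'a set \<Rightarrow> bool" where
  "dominating_set G S \<longleftrightarrow>
     S \<subseteq> pverts G \<and> (\<forall>v \<in> pverts G - S. \<exists>u \<in> S. (v, u) \<in> parcs G)"

definition avd :: "'a pair_pre_digraph \<Rightarrow> real" where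
  "avd G = (\<Sum>S | dominating_set G S. real (card S)) / real (card {S. dominating_set G S})"

end

theory Submission
  imports Defs
begin

text \<open>
  Call a vertex free if it need not be dominated, and excluded if it must not be chosen. With
  \<open>Z\<close> the free and \<open>R\<close> the excluded vertices, the claim is that \<open>3|S| - 2|V|\<close> sums to at most \<open>0\<close>
  over all admitted sets \<open>S\<close>, provided that every isolated vertex lies in \<open>Z \<union> R\<close>, that \<open>R\<close> meets each
  component at most once, and that in the components meeting \<open>R\<close> no vertex has more than two leaf
  neighbours outside \<open>Z \<union> R\<close>. This is proved by induction on the number of vertices and edges.

  If \<open>i \<in> R\<close>, the leaves at \<open>i\<close> are forced into \<open>S\<close>; otherwise one splits on whether a fixed
  neighbour \<open>j\<close> of \<open>i\<close> is chosen, where \<open>j \<notin> S\<close> amounts to deleting the edge and excluding \<open>j\<close>.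
  If \<open>R\<close> is empty and some vertex \<open>v\<close> has at least two leaves, one splits on \<open>v \<in> S\<close>. If no vertex has
  more than two leaves, deleting an edge \<open>uv\<close> whose ends are no leaves loses only sets in
  which, say, \<open>u\<close> alone dominates \<open>v\<close>; these exclude all other neighbours of \<open>v\<close>, and their sum is
  at most minus their number. What remains are single edges and isolated free vertices.

  A vertex with three or more leaves makes the sum for the split at \<open>v\<close> negative, and a non-leaf without leaves makes an
  edge deletion lose some set. Conversely, if neither occurs, the stars around the support
  vertices are independent of each other and each contributes \<open>0\<close>.
\<close>

section \<open>Excess of families of dominating sets\<close>

text \<open>Intersecting with \<open>V\<close> allows vertices to be deleted by shrinking
  \<open>V\<close> while \<open>E\<close> stays fixed.\<close>

definition nbrs :: "'a set \<Rightarrow> 'a rel \<Rightarrow> 'a \<Rightarrow> 'a set" where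
  "nbrs V E x = {y \<in> V. (x, y) \<in> E}"

definition dom_sets :: "'a set \<Rightarrow> 'a rel \<Rightarrow> 'a set \<Rightarrow> 'a set \<Rightarrow> 'a set set" where
  "dom_sets V E Z R = {S. S \<subseteq> V - R \<and> (\<forall>x \<in> V - Z. x \<in> S \<or> (\<exists>y \<in> S. (x, y) \<in> E))}"

text \<open>For a nonempty family the sign compares the mean size with \<open>2 * m / 3\<close>.
  Unlike the mean, this sum is additive over disjoint families, so case splits on \<open>S\<close>
  add up.\<close>

definition excess :: "nat \<Rightarrow> 'a set set \<Rightarrow> real" where
  "excess m F = (\<Sum>S\<in>F. 3 * real (card S) - 2 * real m)"

definition leaves :: "'a set \<Rightarrow> 'a rel \<Rightarrow> 'a set \<Rightarrow> 'a \<Rightarrow> 'a set" where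
  "leaves V E Z w = {x \<in> V - Z. nbrs V E x = {w}}"

text \<open>Every edge is a bridge. Reflexivity of the closure also rules out loops.\<close>

definition edge_acyclic :: "'a rel \<Rightarrow> bool" where
  "edge_acyclic E \<longleftrightarrow> (\<forall>u v. (u, v) \<in> E \<longrightarrow> (u, v) \<notin> (E - {(u, v), (v, u)})\<^sup>*)"

section \<open>Elementary facts on neighbourhoods, leaves and dominating sets\<close>

lemma nbrs_subset: "nbrs V E x \<subseteq> V"
  by (auto simp: nbrs_def)

lemma finite_leaves [simp]: "finite V \<Longrightarrow> finite (leaves V E Z w)"
  by (auto simp: leaves_def)

lemma leaves_subset: "leaves V E Z w \<subseteq> V"
  by (auto simp: leaves_def)

lemma leaf_edge: "x \<in> leaves V E Z w \<Longrightarrow> (x, w) \<in> E \<and> w \<in> V"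
  by (auto simp: leaves_def nbrs_def)

lemma leaf_nbr_unique: "\<lbrakk>x \<in> leaves V E Z w; y \<in> V; (x, y) \<in> E\<rbrakk> \<Longrightarrow> y = w"
  by (auto simp: leaves_def nbrs_def)

lemma finite_dom_sets [simp]: "finite V \<Longrightarrow> finite (dom_sets V E Z R)"
  by (rule finite_subset[of _ "Pow V"]) (auto simp: dom_sets_def)

lemma dom_sets_subset: "S \<in> dom_sets V E Z R \<Longrightarrow> S \<subseteq> V - R"
  by (auto simp: dom_sets_def)

lemma dom_sets_cong: "V \<inter> Z = V \<inter> Z' \<Longrightarrow> dom_sets V E Z R = dom_sets V E Z' R"
  unfolding dom_sets_def by (rule Collect_cong) blast

lemma dom_sets_mono: "Z \<subseteq> Z' \<Longrightarrow> dom_sets V E Z R \<subseteq> dom_sets V E Z' R"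
  unfolding dom_sets_def by blast

lemma edge_acyclic_irrefl: "edge_acyclic E \<Longrightarrow> (x, x) \<notin> E"
  by (auto simp: edge_acyclic_def)

lemma edge_acyclic_subset: "edge_acyclic E \<Longrightarrow> E' \<subseteq> E \<Longrightarrow> edge_acyclic E'"
  unfolding edge_acyclic_def
  by (meson Diff_mono order_refl rtrancl_mono subsetD)

section \<open>Additivity of the excess and its change when vertices are deleted\<close>

lemma excess_empty [simp]: "excess m {} = 0"
  by (simp add: excess_def)

lemma excess_Un_disjoint:
  "\<lbrakk>finite F; finite F'; F \<inter> F' = {}\<rbrakk> \<Longrightarrow> excess m (F \<union> F') = excess m F + excess m F'"
  by (simp add: excess_def sum.union_disjoint)

text \<open>\<open>K\<close> is put back into each set and \<open>d\<close> counts the vertices put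
  back into the graph; they differ when some of these stay unchosen. Each summand shifts by
  \<open>3 * card K - 2 * d\<close>.\<close>

lemma excess_image_Un:
  assumes "\<And>T. T \<in> F \<Longrightarrow> finite T \<and> T \<inter> K = {}" and "finite K"
  shows "excess (m + d) ((\<lambda>T. T \<union> K) ` F)
           = excess m F + (3 * real (card K) - 2 * real d) * real (card F)"
    and "card ((\<lambda>T. T \<union> K) ` F) = card F"
proof -
  have inj: "inj_on (\<lambda>T. T \<union> K) F"
    using assms(1) by (intro inj_onI) blast
  then show "card ((\<lambda>T. T \<union> K) ` F) = card F"
    by (rule card_image)
  have "excess (m + d) ((\<lambda>T. T \<union> K) ` F) = (\<Sum>T\<in>F. 3 * real (card (T \<union> K)) - 2 * real (m + d))"
    unfolding excess_def using inj by (simp add: sum.reindex)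
  also have "\<dots> = (\<Sum>T\<in>F. (3 * real (card T) - 2 * real m) + (3 * real (card K) - 2 * real d))"
    using assms by (intro sum.cong) (auto simp: card_Un_disjoint)
  also have "\<dots> = excess m F + (3 * real (card K) - 2 * real d) * real (card F)"
    by (simp add: excess_def sum.distrib)
  finally show "excess (m + d) ((\<lambda>T. T \<union> K) ` F)
           = excess m F + (3 * real (card K) - 2 * real d) * real (card F)" .
qed

text \<open>Choosing \<open>K\<close> dominates its neighbours, so these become free once
  \<open>K\<close> is deleted.\<close>

lemma dom_sets_containing:
  assumes "sym E" and "K \<subseteq> V - R"
  shows "{S \<in> dom_sets V E Z R. K \<subseteq> S} = (\<lambda>T. T \<union> K) ` dom_sets (V - K) E (Z \<union> E `` K) R"
proof (intro equalityI subsetI)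
  fix S assume S: "S \<in> {S \<in> dom_sets V E Z R. K \<subseteq> S}"
  have "S - K \<in> dom_sets (V - K) E (Z \<union> E `` K) R"
  proof -
    have "x \<in> S - K \<or> (\<exists>y\<in>S - K. (x, y) \<in> E)" if x: "x \<in> V - K - (Z \<union> E `` K)" for x
    proof -
      have "x \<in> S \<or> (\<exists>y\<in>S. (x, y) \<in> E)" using S x by (auto simp: dom_sets_def)
      moreover have "(x, y) \<notin> E" if "y \<in> K" for y using x that symD[OF assms(1), of x y] by auto
      ultimately show ?thesis using x by blast
    qed
    then show ?thesis using S by (auto simp: dom_sets_def)
  qed
  moreover have "S = (S - K) \<union> K" using S by blast
  ultimately show "S \<in> (\<lambda>T. T \<union> K) ` dom_sets (V - K) E (Z \<union> E `` K) R" by blast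
next
  fix S assume "S \<in> (\<lambda>T. T \<union> K) ` dom_sets (V - K) E (Z \<union> E `` K) R"
  then obtain T where T: "T \<in> dom_sets (V - K) E (Z \<union> E `` K) R" and S: "S = T \<union> K" by blast
  have "x \<in> S \<or> (\<exists>y\<in>S. (x, y) \<in> E)" if "x \<in> V - Z" for x
    using T S symD[OF assms(1)] that unfolding dom_sets_def by fast
  then show "S \<in> {S \<in> dom_sets V E Z R. K \<subseteq> S}"
    using T S assms(2) unfolding dom_sets_def by blast
qed

lemma dom_sets_remove_excluded:
  assumes "i \<in> R" and "i \<in> Z"
  shows "dom_sets V E Z R = dom_sets (V - {i}) E Z (R - {i})"
  unfolding dom_sets_def using assms by (intro Collect_cong) blast

text \<open>Once \<open>K\<close> is chosen, \<open>i\<close> is free and excluded, hence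
  irrelevant, and can be deleted along with \<open>K\<close>. The coefficient is
  \<open>3 * card K - 2 * (card K + 1)\<close>.\<close>

lemma excess_remove_excluded_containing:
  assumes "finite V" "sym E" "i \<in> V" "i \<in> R" "K \<subseteq> V - R"
    and dominated: "i \<in> Z \<or> K \<inter> nbrs V E i \<noteq> {}"
  defines "F \<equiv> {S \<in> dom_sets V E Z R. K \<subseteq> S}"
    and "F' \<equiv> dom_sets (V - insert i K) E (Z \<union> E `` K) (R - {i})"
  shows "excess (card V) F = excess (card (V - insert i K)) F' + (real (card K) - 2) * real (card F')"
    and "card F = card F'"
proof -
  have "i \<in> Z \<union> E `` K"
    using dominated \<open>sym E\<close> unfolding nbrs_def sym_def by blast
  moreover have "V - insert i K = V - K - {i}" by blast
  ultimately have "dom_sets (V - K) E (Z \<union> E `` K) R = F'"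
    unfolding F'_def using dom_sets_remove_excluded[OF \<open>i \<in> R\<close>, of "Z \<union> E `` K" "V - K" E]
    by simp
  then have F: "F = (\<lambda>T. T \<union> K) ` F'"
    unfolding F_def by (simp add: dom_sets_containing[OF assms(2,5)])
  have K: "finite K" using assms finite_subset by blast
  have T: "finite T \<and> T \<inter> K = {}" if "T \<in> F'" for T
  proof -
    have "T \<subseteq> V - insert i K" using that by (auto simp: F'_def dest: dom_sets_subset)
    then show ?thesis using \<open>finite V\<close> by (auto intro: finite_subset)
  qed
  have card_V: "card V = card (V - insert i K) + (1 + card K)"
  proof -
    have "card (insert i K) = 1 + card K" using assms K by (subst card_insert_disjoint) auto
    moreover have "insert i K \<subseteq> V" using assms by blast
    ultimately show ?thesis
      using assms K card_Diff_subset[of "insert i K" V] card_mono[of V "insert i K"] by simp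
  qed
  show "card F = card F'" unfolding F using excess_image_Un(2)[OF T K] by simp
  show "excess (card V) F = excess (card (V - insert i K)) F' + (real (card K) - 2) * real (card F')"
    unfolding F using excess_image_Un(1)[OF T K, of F' "card (V - insert i K)" "1 + card K"]
    by (simp add: card_V algebra_simps)
qed

text \<open>The vertex is in or out independently of the rest: in shifts a summand by
  \<open>3 - 2\<close>, out by \<open>- 2\<close>, together \<open>- 1\<close> per smaller
  set.\<close>

lemma excess_remove_free_vertex:
  assumes "finite V" "sym E" "x \<in> V" "x \<in> Z" "x \<notin> R" "nbrs V E x = {}"
  defines "F' \<equiv> dom_sets (V - {x}) E Z R"
  shows "excess (card V) (dom_sets V E Z R) = 2 * excess (card (V - {x})) F' - real (card F')"
    and "card (dom_sets V E Z R) = 2 * card F'"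
proof -
  let ?F = "(\<lambda>T. T \<union> {x}) ` F'"
  have noE: "(x, y) \<notin> E" "(y, x) \<notin> E" if "y \<in> V" for y
    using assms(2,6) that unfolding nbrs_def sym_def by blast+
  have F': "T \<subseteq> V - {x}" if "T \<in> F'" for T
    using that by (auto simp: F'_def dest: dom_sets_subset)
  have "{S \<in> dom_sets V E Z R. {x} \<subseteq> S} = (\<lambda>T. T \<union> {x}) ` dom_sets (V - {x}) E (Z \<union> E `` {x}) R"
    using assms by (intro dom_sets_containing) auto
  also have "dom_sets (V - {x}) E (Z \<union> E `` {x}) R = F'"
    unfolding F'_def using noE by (intro dom_sets_cong) auto
  finally have "{S \<in> dom_sets V E Z R. {x} \<subseteq> S} = ?F" .
  moreover have "{S \<in> dom_sets V E Z R. x \<notin> S} = F'"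
    unfolding dom_sets_def F'_def using assms(4) by (intro Collect_cong) blast
  ultimately have split: "dom_sets V E Z R = F' \<union> ?F" by blast
  have disj: "F' \<inter> ?F = {}" using F' by blast
  have fin: "finite F'" using assms(1) by (simp add: F'_def)
  have T: "finite T \<and> T \<inter> {x} = {}" if "T \<in> F'" for T
    using F'[OF that] assms(1) finite_subset by blast
  have cV: "card V = card (V - {x}) + 1"
    using assms(1,3) by (metis Suc_eq_plus1 card_Suc_Diff1)
  show "card (dom_sets V E Z R) = 2 * card F'"
    unfolding split using excess_image_Un(2)[OF T, of F'] fin disj by (simp add: card_Un_disjoint)
  have "excess (card V) (dom_sets V E Z R) = excess (card V) F' + excess (card V) ?F"
    unfolding split using fin disj by (intro excess_Un_disjoint) auto
  also have "excess (card V) ?F = excess (card (V - {x})) F' + real (card F')"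
    using excess_image_Un(1)[OF T, of F' "card (V - {x})" 1] by (simp add: cV)
  \<comment> \<open>\<open>K = {}\<close> with \<open>d = 1\<close>: the sets stay the same and only
    the number of vertices changes.\<close>
  also have "excess (card V) F' = excess (card (V - {x})) F' - 2 * real (card F')"
    using excess_image_Un(1)[of F' "{}" "card (V - {x})" 1] T by (simp add: cV)
  finally show "excess (card V) (dom_sets V E Z R) = 2 * excess (card (V - {x})) F' - real (card F')"
    by simp
qed

text \<open>All subsets of \<open>J\<close> can be added. Their mean size is
  \<open>card J / 2\<close>, and \<open>3 * card J / 2 - 2 * card J = - card J / 2\<close>.\<close>

lemma excess_remove_free_set:
  assumes "finite J" "finite V" "sym E" "J \<subseteq> V" "J \<subseteq> Z" "J \<inter> R = {}"
    and "\<And>x. x \<in> J \<Longrightarrow> nbrs V E x = {}"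
  shows "excess (card V) (dom_sets V E Z R)
           = 2 ^ card J * (excess (card (V - J)) (dom_sets (V - J) E Z R)
                            - real (card J) / 2 * real (card (dom_sets (V - J) E Z R))) \<and>
         card (dom_sets V E Z R) = 2 ^ card J * card (dom_sets (V - J) E Z R)"
  using assms
proof (induction J rule: finite_induct)
  case empty
  then show ?case by simp
next
  case (insert x J)
  let ?W = "V - J"
  have W: "finite ?W" "x \<in> ?W" "x \<in> Z" "x \<notin> R" "nbrs ?W E x = {}"
    using insert.prems insert.hyps by (auto simp: nbrs_def)
  note step = excess_remove_free_vertex[OF W(1) insert.prems(2) W(2-5)]
  have VW: "?W - {x} = V - insert x J" by blast
  have IH: "excess (card V) (dom_sets V E Z R)
           = 2 ^ card J * (excess (card ?W) (dom_sets ?W E Z R)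
                            - real (card J) / 2 * real (card (dom_sets ?W E Z R)))"
       "card (dom_sets V E Z R) = 2 ^ card J * card (dom_sets ?W E Z R)"
    using insert by auto
  show ?case
    unfolding IH step[unfolded VW] using insert.hyps by (simp add: algebra_simps)
qed

section \<open>Stars and edge deletion\<close>

text \<open>Split on \<open>v \<in> S\<close>. If \<open>v\<close> is chosen, it contributes
  \<open>3 - 2\<close> and its leaves turn into isolated free vertices. Otherwise its leaves are
  forced, and deleting \<open>v\<close> with them shifts each summand by
  \<open>card J - 2\<close>.\<close>

lemma excess_star:
  fixes Z :: "'a set"
  assumes "finite V" "sym E" "edge_acyclic E" "v \<in> V"
  defines "J \<equiv> leaves V E Z v"
  defines "W \<equiv> V - insert v J"
  defines "F1 \<equiv> dom_sets W E (Z \<union> E `` {v}) {}" and "F2 \<equiv> dom_sets W E Z {}"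
  assumes "J \<noteq> {}"
  shows "excess (card V) (dom_sets V E Z {})
     = 2 ^ card J * (excess (card W) F1 + (1 - real (card J) / 2) * real (card F1))
       + excess (card W) F2 + (real (card J) - 2) * real (card F2)"
proof -
  let ?D = "dom_sets V E Z {}"
  let ?Z1 = "Z \<union> E `` {v}"
  have vJ: "v \<notin> J"
    using leaf_edge[of v V E Z v] edge_acyclic_irrefl[OF assms(3)] by (auto simp: J_def)
  have finJ: "finite J" using assms(1) by (simp add: J_def)
  have JV: "J \<subseteq> V" by (simp add: J_def leaves_subset)
  have Jv: "(x, v) \<in> E" "(v, x) \<in> E" if "x \<in> J" for x
    using leaf_edge[of x V E Z v] symD[OF assms(2)] that by (auto simp: J_def)
  have J_only: "y = v" if "x \<in> J" "y \<in> V" "(x, y) \<in> E" for x y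
    using leaf_nbr_unique[of x V E Z v y] that by (simp add: J_def)
  have WJ: "V - {v} - J = W" by (auto simp: W_def)
  have in_image: "{S \<in> ?D. {v} \<subseteq> S} = (\<lambda>T. T \<union> {v}) ` dom_sets (V - {v}) E ?Z1 {}"
    using assms by (intro dom_sets_containing) auto
  have T: "finite T \<and> T \<inter> {v} = {}" if "T \<in> dom_sets (V - {v}) E ?Z1 {}" for T
    using dom_sets_subset[OF that] assms(1) by (auto intro: finite_subset)
  have cV: "card V = card (V - {v}) + 1"
    using assms(1,4) by (metis Suc_eq_plus1 card_Suc_Diff1)
  have "excess (card V) {S \<in> ?D. {v} \<subseteq> S}
      = excess (card (V - {v})) (dom_sets (V - {v}) E ?Z1 {}) + real (card (dom_sets (V - {v}) E ?Z1 {}))"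
    unfolding in_image using excess_image_Un(1)[OF T, of _ "card (V - {v})" 1] by (simp add: cV)
  moreover have "excess (card (V - {v})) (dom_sets (V - {v}) E ?Z1 {})
           = 2 ^ card J * (excess (card W) F1 - real (card J) / 2 * real (card F1)) \<and>
         card (dom_sets (V - {v}) E ?Z1 {}) = 2 ^ card J * card F1"
    unfolding F1_def WJ[symmetric]
    by (rule excess_remove_free_set) (use assms(1,2) finJ JV vJ Jv J_only in \<open>auto simp: nbrs_def\<close>)
  ultimately have in_part: "excess (card V) {S \<in> ?D. {v} \<subseteq> S}
      = 2 ^ card J * (excess (card W) F1 + (1 - real (card J) / 2) * real (card F1))"
    by (simp add: algebra_simps)
  have forced: "J \<subseteq> S" if "S \<in> dom_sets V E Z {v}" for S
  proof
    fix x assume x: "x \<in> J"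
    then have "x \<in> V - Z" by (simp add: J_def leaves_def)
    then have "x \<in> S \<or> (\<exists>y\<in>S. (x, y) \<in> E)" using that by (auto simp: dom_sets_def)
    then show "x \<in> S" using J_only[OF x] dom_sets_subset[OF that] by blast
  qed
  have "{S \<in> ?D. v \<notin> S} = dom_sets V E Z {v}" unfolding dom_sets_def by blast
  then have out: "{S \<in> ?D. v \<notin> S} = {S \<in> dom_sets V E Z {v}. J \<subseteq> S}" using forced by blast
  \<comment> \<open>The leaves see only \<open>v\<close>, so choosing them frees nothing in
    \<open>W\<close>.\<close>
  have "E `` J \<inter> W = {}" using J_only by (auto simp: W_def)
  then have F2: "dom_sets W E (Z \<union> E `` J) ({v} - {v}) = F2"
    unfolding F2_def by (auto intro!: dom_sets_cong)
  have "J \<inter> nbrs V E v \<noteq> {}" using \<open>J \<noteq> {}\<close> Jv JV by (auto simp: nbrs_def)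
  then have out_part: "excess (card V) {S \<in> ?D. v \<notin> S}
      = excess (card W) F2 + (real (card J) - 2) * real (card F2)"
    unfolding out using excess_remove_excluded_containing(1)[of V E v "{v}" J Z] assms(1,2,4) JV vJ F2
    by (simp add: W_def subset_Diff_insert)
  have "excess (card V) ?D = excess (card V) {S \<in> ?D. {v} \<subseteq> S} + excess (card V) {S \<in> ?D. v \<notin> S}"
  proof -
    have "{S \<in> ?D. {v} \<subseteq> S} \<union> {S \<in> ?D. v \<notin> S} = ?D" by blast
    moreover have "finite ?D" using assms(1) by simp
    ultimately show ?thesis
      using excess_Un_disjoint[of "{S \<in> ?D. {v} \<subseteq> S}" "{S \<in> ?D. v \<notin> S}" "card V"] by auto
  qed
  then show ?thesis using in_part out_part by simp
qed

text \<open>The dominating sets in which \<open>v\<close> is dominated only through the edge to \<open>u\<close>.\<close>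

definition lost_sets :: "'a set \<Rightarrow> 'a rel \<Rightarrow> 'a set \<Rightarrow> 'a \<Rightarrow> 'a \<Rightarrow> 'a set set" where
  "lost_sets V E Z u v = (if v \<in> Z then {}
     else {S \<in> dom_sets V E Z (insert v (nbrs V E v - {u})). {u} \<subseteq> S})"

text \<open>Losing the edge hurts only an unchosen, non-free end whose single chosen neighbour was
  the other end. The two kinds of lost sets disagree on which end is chosen.\<close>

lemma dom_sets_delete_edge:
  assumes "u \<in> V" "v \<in> V"
  shows "dom_sets V E Z {} = dom_sets V (E - {(u, v), (v, u)}) Z {}
           \<union> (lost_sets V E Z u v \<union> lost_sets V E Z v u)"
    and "dom_sets V (E - {(u, v), (v, u)}) Z {} \<inter> (lost_sets V E Z u v \<union> lost_sets V E Z v u) = {}"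
    and "lost_sets V E Z u v \<inter> lost_sets V E Z v u = {}"
proof -
  let ?E = "E - {(u, v), (v, u)}"
  have lost_iff: "S \<in> lost_sets V E Z u v \<longleftrightarrow>
      S \<in> dom_sets V E Z {} \<and> u \<in> S \<and> v \<notin> S \<and> v \<notin> Z \<and> (\<forall>y\<in>S. (v, y) \<in> E \<longrightarrow> y = u)" for S u v
    unfolding lost_sets_def dom_sets_def nbrs_def by auto
  show "lost_sets V E Z u v \<inter> lost_sets V E Z v u = {}"
    by (auto simp: lost_iff)
  show "dom_sets V E Z {} = dom_sets V ?E Z {} \<union> (lost_sets V E Z u v \<union> lost_sets V E Z v u)"
  proof (intro equalityI subsetI)
    fix S assume S: "S \<in> dom_sets V E Z {}"
    show "S \<in> dom_sets V ?E Z {} \<union> (lost_sets V E Z u v \<union> lost_sets V E Z v u)"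
    proof (cases "S \<in> dom_sets V ?E Z {}")
      case False
      then obtain x where x: "x \<in> V - Z" "x \<notin> S" "\<forall>y\<in>S. (x, y) \<notin> ?E"
        using S by (auto simp: dom_sets_def)
      moreover obtain y where y: "y \<in> S" "(x, y) \<in> E"
        using S x by (auto simp: dom_sets_def)
      ultimately have "(x, y) = (u, v) \<or> (x, y) = (v, u)" by blast
      then show ?thesis
      proof
        assume "(x, y) = (u, v)"
        then have "S \<in> lost_sets V E Z v u" unfolding lost_iff using S x y by blast
        then show ?thesis by blast
      next
        assume "(x, y) = (v, u)"
        then have "S \<in> lost_sets V E Z u v" unfolding lost_iff using S x y by blast
        then show ?thesis by blast
      qed
    qed blast
  next
    fix S assume "S \<in> dom_sets V ?E Z {} \<union> (lost_sets V E Z u v \<union> lost_sets V E Z v u)"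
    moreover have "dom_sets V ?E Z {} \<subseteq> dom_sets V E Z {}" unfolding dom_sets_def by blast
    ultimately show "S \<in> dom_sets V E Z {}" by (auto simp: lost_iff)
  qed
  show "dom_sets V ?E Z {} \<inter> (lost_sets V E Z u v \<union> lost_sets V E Z v u) = {}"
  proof -
    have "S \<notin> dom_sets V ?E Z {}" if "S \<in> lost_sets V E Z u v" for S
    proof -
      have "v \<in> V - Z" "v \<notin> S" "\<forall>y\<in>S. (v, y) \<notin> ?E" using that assms(2) by (auto simp: lost_iff)
      then show ?thesis by (auto simp: dom_sets_def)
    qed
    moreover have "S \<notin> dom_sets V ?E Z {}" if "S \<in> lost_sets V E Z v u" for S
    proof -
      have "u \<in> V - Z" "u \<notin> S" "\<forall>y\<in>S. (u, y) \<notin> ?E" using that assms(1) by (auto simp: lost_iff)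
      then show ?thesis by (auto simp: dom_sets_def)
    qed
    ultimately show ?thesis by blast
  qed
qed

text \<open>In a lost set \<open>u\<close> is chosen, while \<open>v\<close> and its other
  neighbours are not. Deleting \<open>v\<close> with \<open>K = {u}\<close> shifts each summand by
  \<open>1 - 2\<close>.\<close>

lemma excess_lost_sets:
  assumes "finite V" "sym E" "edge_acyclic E" "u \<in> V" "v \<in> V" "(u, v) \<in> E"
  assumes "excess (card (V - {v, u})) (dom_sets (V - {v, u}) E (Z \<union> E `` {u}) (nbrs V E v - {u})) \<le> 0"
  shows "excess (card V) (lost_sets V E Z u v) \<le> - real (card (lost_sets V E Z u v))"
proof (cases "v \<in> Z")
  case True
  then show ?thesis by (simp add: lost_sets_def)
next
  case False
  have irr: "(v, v) \<notin> E" "u \<noteq> v" using edge_acyclic_irrefl[OF assms(3)] assms(6) by auto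
  have vu: "(v, u) \<in> E" using symD[OF assms(2,6)] .
  have "insert v (nbrs V E v - {u}) - {v} = nbrs V E v - {u}" using irr by (auto simp: nbrs_def)
  then show ?thesis
    using excess_remove_excluded_containing[of V E v "insert v (nbrs V E v - {u})" "{u}" Z]
      assms irr vu False by (simp add: lost_sets_def nbrs_def)
qed

section \<open>Admissible configurations\<close>

text \<open>An isolated vertex outside \<open>Z \<union> R\<close> would be forced into every set
  and push the excess up. The leaf bound keeps the shift \<open>card K - 2\<close> nonpositive when
  leaves at an excluded vertex are forced; it covers the whole component because cutting an edge
  also excludes a neighbour.\<close>

definition admissible :: "'a set \<Rightarrow> 'a rel \<Rightarrow> 'a set \<Rightarrow> 'a set \<Rightarrow> bool" where
  "admissible V E Z R \<longleftrightarrow> finite V \<and> finite E \<and> sym E \<and> edge_acyclic E \<and> R \<subseteq> V \<and>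
     (\<forall>x \<in> V - Z - R. nbrs V E x \<noteq> {}) \<and>
     (\<forall>r \<in> R. \<forall>r' \<in> R. r \<noteq> r' \<longrightarrow> (r, r') \<notin> (Restr E V)\<^sup>*) \<and>
     (\<forall>r \<in> R. \<forall>w. (r, w) \<in> (Restr E V)\<^sup>* \<longrightarrow> card (leaves V E (Z \<union> R) w) \<le> 2)"

section \<open>Preservation of admissibility under deletions\<close>

lemma rtrancl_Restr_mono:
  "\<lbrakk>(a, b) \<in> (Restr E W)\<^sup>*; W \<subseteq> V\<rbrakk> \<Longrightarrow> (a, b) \<in> (Restr E V)\<^sup>*"
  by (rule rtrancl_mono[THEN subsetD, rotated]) auto

text \<open>Neighbours of \<open>K\<close> become free, so a newly isolated vertex that matters had
  \<open>i\<close> as its only neighbour, and such leaves lie in \<open>K\<close>.\<close>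

lemma admissible_remove_excluded:
  assumes adm: "admissible V E Z R" and i: "i \<in> R" and K: "K \<subseteq> V - R"
    and lv: "leaves V E (Z \<union> R) i \<subseteq> K"
  shows "admissible (V - insert i K) E (Z \<union> E `` K) (R - {i})"
proof -
  let ?W = "V - insert i K" and ?Z = "Z \<union> E `` K" and ?R = "R - {i}"
  have symE: "(x, y) \<in> E \<Longrightarrow> (y, x) \<in> E" for x y using adm by (auto simp: admissible_def dest: symD)
  have fin: "finite V" using adm by (simp add: admissible_def)
  have iV: "i \<in> V" using adm i by (auto simp: admissible_def)
  have sep: "(r, r') \<notin> (Restr E V)\<^sup>*" if "r \<in> R" "r' \<in> R" "r \<noteq> r'" for r r'
    using adm that by (auto simp: admissible_def)
  have iso: "nbrs ?W E x \<noteq> {}" if x: "x \<in> ?W - ?Z - ?R" for x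
  proof
    assume empty: "nbrs ?W E x = {}"
    have "nbrs V E x \<noteq> {}" using adm x by (auto simp: admissible_def)
    moreover have "nbrs V E x \<subseteq> {i}" using empty x symE by (auto simp: nbrs_def)
    ultimately have "nbrs V E x = {i}" by auto
    then have "x \<in> leaves V E (Z \<union> R) i" using x by (auto simp: leaves_def)
    then show False using lv x by auto
  qed
  have lf: "card (leaves ?W E (?Z \<union> ?R) w) \<le> 2" if r: "r \<in> ?R" and w: "(r, w) \<in> (Restr E ?W)\<^sup>*" for r w
  proof -
    have rw: "(r, w) \<in> (Restr E V)\<^sup>*" using w by (rule rtrancl_Restr_mono) auto
    have "leaves ?W E (?Z \<union> ?R) w \<subseteq> leaves V E (Z \<union> R) w"
    proof
      fix x assume x: "x \<in> leaves ?W E (?Z \<union> ?R) w"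
      then have x': "x \<in> ?W - ?Z - ?R" "nbrs ?W E x = {w}" by (auto simp: leaves_def)
      then have wx: "(w, x) \<in> Restr E V" using symE by (auto simp: nbrs_def)
      \<comment> \<open>Only the loss of \<open>i\<close> could make \<open>x\<close> a new leaf,
        but then \<open>i\<close> would lie in the component of \<open>r\<close>.\<close>
      have "(x, i) \<notin> E"
      proof
        assume "(x, i) \<in> E"
        then have "(x, i) \<in> Restr E V" using x' iV by auto
        with rw wx have "(r, i) \<in> (Restr E V)\<^sup>*" by (meson rtrancl.rtrancl_into_rtrancl)
        then show False using sep[of r i] r i by auto
      qed
      moreover have "(x, k) \<notin> E" if "k \<in> K" for k using x' that symE by auto
      ultimately have "nbrs V E x = nbrs ?W E x" by (auto simp: nbrs_def)
      then show "x \<in> leaves V E (Z \<union> R) w" using x' by (auto simp: leaves_def)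
    qed
    then have "card (leaves ?W E (?Z \<union> ?R) w) \<le> card (leaves V E (Z \<union> R) w)"
      using fin by (intro card_mono) auto
    also have "\<dots> \<le> 2" using adm r rw by (auto simp: admissible_def)
    finally show ?thesis .
  qed
  have sep': "(r, r') \<notin> (Restr E ?W)\<^sup>*" if "r \<in> ?R" "r' \<in> ?R" "r \<noteq> r'" for r r'
    using sep[of r r'] that rtrancl_Restr_mono[of r r' E ?W V] by auto
  have "?R \<subseteq> ?W" using adm K by (auto simp: admissible_def)
  then show ?thesis
    using iso lf sep' adm unfolding admissible_def by simp
qed

text \<open>The edge is a bridge, so the cut separates \<open>i\<close> from \<open>j\<close>. Only
  these two vertices lose a neighbour, and both are excluded.\<close>

lemma admissible_cut_edge:
  assumes adm: "admissible V E Z R" and i: "i \<in> R" and j: "j \<in> nbrs V E i"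
  shows "admissible V (E - {(i, j), (j, i)}) Z (insert j R)"
proof -
  let ?E = "E - {(i, j), (j, i)}" and ?R = "insert j R"
  have symE: "sym E" and acE: "edge_acyclic E" and fin: "finite V" "finite E"
    using adm by (auto simp: admissible_def)
  have symE': "sym ?E" using symE by (auto simp: sym_def)
  have ij: "(i, j) \<in> E" "j \<in> V" "i \<in> V" using i j adm by (auto simp: nbrs_def admissible_def)
  have sep: "(r, r') \<notin> (Restr E V)\<^sup>*" if "r \<in> R" "r' \<in> R" "r \<noteq> r'" for r r'
    using adm that by (auto simp: admissible_def)
  have ijV: "(i, j) \<in> (Restr E V)\<^sup>*" using ij by auto
  have mono: "(a, b) \<in> (Restr ?E V)\<^sup>* \<Longrightarrow> (a, b) \<in> (Restr E V)\<^sup>*" for a b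
    by (rule rtrancl_mono[THEN subsetD, rotated]) auto
  have cut: "(i, j) \<notin> (Restr ?E V)\<^sup>*"
  proof
    assume "(i, j) \<in> (Restr ?E V)\<^sup>*"
    then have "(i, j) \<in> ?E\<^sup>*" by (rule rtrancl_mono[THEN subsetD, rotated]) auto
    then show False using acE ij by (auto simp: edge_acyclic_def)
  qed
  have sym_rt: "sym ((Restr ?E V)\<^sup>*)"
    by (rule sym_rtrancl) (use symE in \<open>auto simp: sym_def\<close>)
  have sep_j: "(r, j) \<notin> (Restr ?E V)\<^sup>*" if "r \<in> R" for r
  proof (cases "r = i")
    case True then show ?thesis using cut by simp
  next
    case False
    show ?thesis
    proof
      assume "(r, j) \<in> (Restr ?E V)\<^sup>*"
      then have "(r, j) \<in> (Restr E V)\<^sup>*" by (rule mono)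
      moreover have "(j, i) \<in> (Restr E V)\<^sup>*" using ij symD[OF symE] by auto
      ultimately have "(r, i) \<in> (Restr E V)\<^sup>*" by (rule rtrancl_trans)
      then show False using sep[of r i] False that i by blast
    qed
  qed
  have sep': "(r, r') \<notin> (Restr ?E V)\<^sup>*" if "r \<in> ?R" "r' \<in> ?R" "r \<noteq> r'" for r r'
    using that sep mono sep_j symD[OF sym_rt] by blast
  have nb: "nbrs V ?E x = nbrs V E x" if "x \<notin> ?R" for x
    using that i by (auto simp: nbrs_def)
  have iso: "nbrs V ?E x \<noteq> {}" if "x \<in> V - Z - ?R" for x
    using that adm by (simp add: nb admissible_def)
  have lf: "card (leaves V ?E (Z \<union> ?R) w) \<le> 2" if r: "r \<in> ?R" and w: "(r, w) \<in> (Restr ?E V)\<^sup>*" for r w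
  proof -
    \<comment> \<open>The component of \<open>j\<close> after the cut is part of the old component
      of \<open>i\<close> and inherits its leaf bound.\<close>
    obtain r' where "r' \<in> R" "(r', w) \<in> (Restr E V)\<^sup>*"
    proof (cases "r = j")
      case True
      then have "(i, w) \<in> (Restr E V)\<^sup>*" using mono[OF w] ijV by (meson rtrancl_trans)
      then show ?thesis using that i by blast
    next
      case False
      then show ?thesis using that r mono[OF w] by blast
    qed
    then have "card (leaves V E (Z \<union> R) w) \<le> 2" using adm by (auto simp: admissible_def)
    moreover have "leaves V ?E (Z \<union> ?R) w \<subseteq> leaves V E (Z \<union> R) w"
    proof
      fix x assume x: "x \<in> leaves V ?E (Z \<union> ?R) w"
      then have "x \<notin> ?R" by (simp add: leaves_def)
      then show "x \<in> leaves V E (Z \<union> R) w" using x nb[of x] by (simp add: leaves_def)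
    qed
    ultimately show ?thesis
      using card_mono[of "leaves V E (Z \<union> R) w" "leaves V ?E (Z \<union> ?R) w"] fin by simp
  qed
  have "edge_acyclic ?E" using edge_acyclic_subset[OF acE, of ?E] by auto
  then show ?thesis
    using iso lf sep' symE' adm ij unfolding admissible_def by simp
qed

lemma admissible_no_excluded_iff:
  "admissible V E Z {} \<longleftrightarrow> finite V \<and> finite E \<and> sym E \<and> edge_acyclic E \<and>
     (\<forall>x \<in> V - Z. nbrs V E x \<noteq> {})"
  by (auto simp: admissible_def)

text \<open>Leaves at \<open>v\<close> have no other neighbour, so a remaining non-free vertex left
  isolated would have been adjacent to \<open>v\<close> only and thus a leaf at \<open>v\<close>
  itself.\<close>

lemma admissible_remove_star:
  assumes adm: "admissible V E Z {}"
  shows "admissible (V - insert v (leaves V E Z v)) E (Z \<union> E `` {v}) {}"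
    and "admissible (V - insert v (leaves V E Z v)) E Z {}"
proof -
  let ?J = "leaves V E Z v" let ?W = "V - insert v ?J"
  have symE: "(x, y) \<in> E \<Longrightarrow> (y, x) \<in> E" for x y using adm by (auto simp: admissible_def dest: symD)
  have *: "nbrs ?W E x \<noteq> {}" if x: "x \<in> ?W - Z" for x
  proof
    assume empty: "nbrs ?W E x = {}"
    have "nbrs V E x \<noteq> {}" using adm x by (auto simp: admissible_def)
    moreover have "nbrs V E x \<subseteq> {v}"
    proof
      fix y assume y: "y \<in> nbrs V E x"
      then have "y \<in> insert v ?J" using empty by (auto simp: nbrs_def)
      moreover have "y \<notin> ?J" using leaf_nbr_unique[of y V E Z v x] x y symE by (auto simp: nbrs_def)
      ultimately show "y \<in> {v}" by simp
    qed
    ultimately have "nbrs V E x = {v}" by auto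
    then show False using x by (auto simp: leaves_def)
  qed
  then show "admissible ?W E Z {}" using adm by (auto simp: admissible_no_excluded_iff)
  show "admissible ?W E (Z \<union> E `` {v}) {}" using adm * by (auto simp: admissible_no_excluded_iff)
qed

text \<open>After \<open>v\<close> is deleted its neighbours lie in different components, since a
  path between two of them would close a cycle through \<open>v\<close>. Vertices neither free nor
  excluded lose no neighbour.\<close>

lemma admissible_lost_sets:
  assumes adm: "admissible V E Z {}" and few: "\<And>w. card (leaves V E Z w) \<le> 2"
    and uv: "(u, v) \<in> E" "u \<in> V" "v \<in> V"
  shows "admissible (V - {v, u}) E (Z \<union> E `` {u}) (nbrs V E v - {u})"
proof -
  let ?W = "V - {v, u}" and ?Z = "Z \<union> E `` {u}" and ?R = "nbrs V E v - {u}"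
  have symE: "(x, y) \<in> E \<Longrightarrow> (y, x) \<in> E" for x y using adm by (auto simp: admissible_def dest: symD)
  have fin: "finite V" and ac: "edge_acyclic E" using adm by (auto simp: admissible_def)
  have nb: "nbrs ?W E x = nbrs V E x" if "x \<in> ?W - ?Z - ?R" for x
    using that symE by (auto simp: nbrs_def)
  have iso: "nbrs ?W E x \<noteq> {}" if "x \<in> ?W - ?Z - ?R" for x
    using nb[OF that] that adm by (auto simp: admissible_def)
  have lf: "card (leaves ?W E (?Z \<union> ?R) w) \<le> 2" for w
  proof -
    have "leaves ?W E (?Z \<union> ?R) w \<subseteq> leaves V E Z w" using nb by (auto simp: leaves_def)
    then show ?thesis using card_mono[of "leaves V E Z w"] few[of w] fin by (meson finite_leaves order_trans)
  qed
  have sep: "(r, r') \<notin> (Restr E ?W)\<^sup>*" if "r \<in> ?R" "r' \<in> ?R" "r \<noteq> r'" for r r'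
  proof
    assume "(r, r') \<in> (Restr E ?W)\<^sup>*"
    then have "(r, r') \<in> (E - {(r, v), (v, r)})\<^sup>*" by (rule rtrancl_mono[THEN subsetD, rotated]) auto
    moreover have "(r', v) \<in> E - {(r, v), (v, r)}"
      using that symE edge_acyclic_irrefl[OF ac] by (auto simp: nbrs_def)
    ultimately have "(r, v) \<in> (E - {(r, v), (v, r)})\<^sup>*" by (rule rtrancl_into_rtrancl)
    moreover have "(r, v) \<in> E" using that symE by (auto simp: nbrs_def)
    ultimately show False using ac by (auto simp: edge_acyclic_def)
  qed
  have "?R \<subseteq> ?W" using edge_acyclic_irrefl[OF ac] by (auto simp: nbrs_def)
  then show ?thesis using iso lf sep adm unfolding admissible_def by simp
qed

text \<open>A non-free vertex isolated by the deletion would have been a leaf at the other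
  end.\<close>

lemma admissible_delete_edge:
  assumes adm: "admissible V E Z {}" and "u \<notin> leaves V E Z v" "v \<notin> leaves V E Z u"
    and "(u, v) \<in> E" "u \<in> V" "v \<in> V"
  shows "admissible V (E - {(u, v), (v, u)}) Z {}"
proof -
  let ?E = "E - {(u, v), (v, u)}"
  have symE: "sym E" using adm by (simp add: admissible_def)
  then have "sym ?E" by (auto simp: sym_def)
  moreover have "edge_acyclic ?E" using adm edge_acyclic_subset[of E ?E] by (auto simp: admissible_def)
  moreover have "nbrs V ?E x \<noteq> {}" if x: "x \<in> V - Z" for x
  proof
    assume empty: "nbrs V ?E x = {}"
    have ne: "nbrs V E x \<noteq> {}" using adm x by (auto simp: admissible_def)
    then have "x = u \<or> x = v" using empty by (auto simp: nbrs_def)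
    then show False
    proof
      assume "x = u"
      then have "nbrs V E u = {v}" using empty ne by (auto simp: nbrs_def)
      then show False using assms(2) x \<open>x = u\<close> by (auto simp: leaves_def)
    next
      assume "x = v"
      then have "nbrs V E v = {u}" using empty ne by (auto simp: nbrs_def)
      then show False using assms(3) x \<open>x = v\<close> by (auto simp: leaves_def)
    qed
  qed
  ultimately show ?thesis using adm by (auto simp: admissible_no_excluded_iff)
qed

section \<open>The excess is nonpositive\<close>

text \<open>For \<open>k\<close> leaves the remainder in \<open>excess_star\<close> is
  \<open>(k - 2) * (card F2 - 2 ^ k / 2 * card F1)\<close>. The second factor is negative:
  \<open>F1\<close> is nonempty, contains \<open>F2\<close> because it has more free vertices, and
  \<open>2 ^ k / 2 \<ge> 2\<close>.\<close>

lemma excess_star_le: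
  assumes adm: "admissible V E Z {}" and v: "v \<in> V" and ge2: "card (leaves V E Z v) \<ge> 2"
    and nonpos: "\<And>Z'. admissible (V - insert v (leaves V E Z v)) E Z' {} \<Longrightarrow>
      excess (card (V - insert v (leaves V E Z v))) (dom_sets (V - insert v (leaves V E Z v)) E Z' {}) \<le> 0"
  shows "excess (card V) (dom_sets V E Z {}) \<le> 0"
    and "card (leaves V E Z v) \<ge> 3 \<Longrightarrow> excess (card V) (dom_sets V E Z {}) < 0"
proof -
  let ?J = "leaves V E Z v"
  let ?W = "V - insert v ?J"
  let ?F1 = "dom_sets ?W E (Z \<union> E `` {v}) {}" and ?F2 = "dom_sets ?W E Z {}"
  define k where "k = card ?J"
  have fin: "finite V" using adm by (simp add: admissible_def)
  have "?J \<noteq> {}" using ge2 by auto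
  then have eq: "excess (card V) (dom_sets V E Z {})
     = 2 ^ k * excess (card ?W) ?F1 + 2 ^ k * ((1 - real k / 2) * real (card ?F1))
       + excess (card ?W) ?F2 + (real k - 2) * real (card ?F2)"
    using adm v unfolding k_def
    by (subst excess_star) (auto simp: admissible_def distrib_left)
  have "excess (card ?W) ?F1 \<le> 0" "excess (card ?W) ?F2 \<le> 0"
    using nonpos admissible_remove_star[OF adm, of v] by auto
  then have "2 ^ k * excess (card ?W) ?F1 + excess (card ?W) ?F2 \<le> 0"
    by (simp add: add_nonpos_nonpos mult_nonneg_nonpos)
  then have le: "excess (card V) (dom_sets V E Z {}) \<le> (real k - 2) * (real (card ?F2) - 2 ^ k / 2 * real (card ?F1))"
    unfolding eq right_diff_distrib by (simp add: field_simps)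
  have "?W \<in> ?F1" by (auto simp: dom_sets_def)
  then have pos: "card ?F1 > 0" using fin by (auto simp: card_gt_0_iff)
  have c12: "card ?F2 \<le> card ?F1" using fin by (intro card_mono dom_sets_mono) auto
  have "2 ^ 2 \<le> (2 :: real) ^ k" using ge2 unfolding k_def by (intro power_increasing) auto
  then have "2 * real (card ?F1) \<le> 2 ^ k / 2 * real (card ?F1)" by (intro mult_right_mono) auto
  then have neg: "real (card ?F2) - 2 ^ k / 2 * real (card ?F1) < 0" using c12 pos by linarith
  show "excess (card V) (dom_sets V E Z {}) \<le> 0"
    using le mult_nonneg_nonpos[of "real k - 2", OF _ less_imp_le[OF neg]] ge2
    by (simp add: k_def)
  show "excess (card V) (dom_sets V E Z {}) < 0" if "card ?J \<ge> 3"
  proof -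
    have "real k - 2 > 0" using that by (simp add: k_def)
    then show ?thesis using le mult_pos_neg[OF _ neg] by fastforce
  qed
qed

text \<open>Each of the two lost families has excess at most minus its size. Keeping one size in the
  bound yields strict inequality later.\<close>

lemma excess_delete_edge:
  assumes adm: "admissible V E Z {}" and uv: "(u, v) \<in> E" "u \<in> V" "v \<in> V"
    and few: "\<And>w. card (leaves V E Z w) \<le> 2"
    and nonpos: "\<And>W Z' R. \<lbrakk>W \<subset> V; admissible W E Z' R\<rbrakk> \<Longrightarrow> excess (card W) (dom_sets W E Z' R) \<le> 0"
  shows "excess (card V) (dom_sets V E Z {})
     \<le> excess (card V) (dom_sets V (E - {(u, v), (v, u)}) Z {}) - real (card (lost_sets V E Z u v))"
proof -
  have fin: "finite V" and symE: "sym E" and ac: "edge_acyclic E" using adm by (auto simp: admissible_def)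
  have vu: "(v, u) \<in> E" using symD[OF symE uv(1)] .
  have fins: "finite (lost_sets V E Z u v)" "finite (lost_sets V E Z v u)"
    using fin by (auto simp: lost_sets_def)
  have "excess (card V) (lost_sets V E Z u v) \<le> - real (card (lost_sets V E Z u v))"
    using excess_lost_sets[OF fin symE ac uv(2,3,1)] admissible_lost_sets[OF adm few uv] nonpos uv(2)
    by blast
  moreover have "excess (card V) (lost_sets V E Z v u) \<le> - real (card (lost_sets V E Z v u))"
    using excess_lost_sets[OF fin symE ac uv(3,2) vu] admissible_lost_sets[OF adm few vu uv(3,2)] nonpos uv(2)
    by blast
  moreover have "excess (card V) (dom_sets V E Z {})
     = excess (card V) (dom_sets V (E - {(u, v), (v, u)}) Z {})
       + (excess (card V) (lost_sets V E Z u v) + excess (card V) (lost_sets V E Z v u))"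
    using dom_sets_delete_edge[OF uv(2,3), of E Z] fin fins
    by (simp add: excess_Un_disjoint)
  ultimately show ?thesis by simp
qed

theorem excess_nonpos:
  assumes "admissible V E Z R"
  shows "excess (card V) (dom_sets V E Z R) \<le> 0"
  using assms
\<comment> \<open>Deleting vertices keeps \<open>E\<close> and lowers \<open>card V\<close>; cutting
  an edge keeps \<open>V\<close> and lowers \<open>card E\<close>.\<close>
proof (induction "card V + card E" arbitrary: V E Z R rule: less_induct)
  case less
  note adm = less.prems
  have fin: "finite V" "finite E" and symE: "sym E" and ac: "edge_acyclic E"
    using adm by (auto simp: admissible_def)
  have IH_V: "excess (card W) (dom_sets W E Z' R') \<le> 0" if "W \<subset> V" "admissible W E Z' R'" for W Z' R'
    using less.hyps[of W E Z' R'] that fin by (simp add: psubset_card_mono)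
  have IH_E: "excess (card V) (dom_sets V (E - {(u, v), (v, u)}) Z' R') \<le> 0"
    if "(u, v) \<in> E" "admissible V (E - {(u, v), (v, u)}) Z' R'" for u v Z' R'
  proof -
    have "card (E - {(u, v), (v, u)}) < card E" using that fin by (intro psubset_card_mono) auto
    then show ?thesis using less.hyps[OF _ that(2)] by simp
  qed
  show ?case
  proof (cases "R = {}")
    case False
    then obtain i where i: "i \<in> R" by blast
    then have iV: "i \<in> V" using adm by (auto simp: admissible_def)
    let ?J = "leaves V E (Z \<union> R) i"
    have J2: "card ?J \<le> 2" using adm i by (auto simp: admissible_def)
    \<comment> \<open>Applied to the leaves at \<open>i\<close> when these are forced, and to
      \<open>{j}\<close> for a chosen neighbour \<open>j\<close>.\<close>
    have remove: "excess (card V) {S \<in> dom_sets V E Z R. K \<subseteq> S} \<le> 0"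
      if K: "K \<subseteq> V - R" "?J \<subseteq> K" "i \<in> Z \<or> K \<inter> nbrs V E i \<noteq> {}" "card K \<le> 2" for K
    proof -
      let ?F' = "dom_sets (V - insert i K) E (Z \<union> E `` K) (R - {i})"
      have "excess (card (V - insert i K)) ?F' \<le> 0"
        using iV by (intro IH_V admissible_remove_excluded[OF adm i K(1,2)]) auto
      moreover have "(real (card K) - 2) * real (card ?F') \<le> 0"
        using K(4) by (intro mult_nonpos_nonneg) auto
      ultimately show ?thesis
        using excess_remove_excluded_containing(1)[OF fin(1) symE iV i K(1,3)] by simp
    qed
    show ?thesis
    \<comment> \<open>The leaves at \<open>i\<close> are forced since \<open>i\<close> cannot be
      chosen. If there are none and \<open>i\<close> is free, \<open>K = {}\<close> simply deletes
      \<open>i\<close>.\<close>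
    proof (cases "i \<in> Z \<or> ?J \<noteq> {}")
      case True
      have "?J \<subseteq> S" if S: "S \<in> dom_sets V E Z R" for S
      proof
        fix x assume x: "x \<in> ?J"
        then have "x \<in> V - Z" by (auto simp: leaves_def)
        then have "x \<in> S \<or> (\<exists>y\<in>S. (x, y) \<in> E)" using S by (auto simp: dom_sets_def)
        then show "x \<in> S" using leaf_nbr_unique[OF x] dom_sets_subset[OF S] i by blast
      qed
      then have "{S \<in> dom_sets V E Z R. ?J \<subseteq> S} = dom_sets V E Z R" by blast
      moreover have "?J \<subseteq> V - R" by (auto simp: leaves_def)
      moreover have "i \<in> Z \<or> ?J \<inter> nbrs V E i \<noteq> {}"
        using True leaf_edge[of _ V E "Z \<union> R" i] symD[OF symE] leaves_subset[of V E "Z \<union> R" i]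
        by (fastforce simp: nbrs_def)
      ultimately show ?thesis using remove[of ?J] J2 by auto
    next
      case False
      show ?thesis
      proof (cases "nbrs V E i = {}")
        case True
        \<comment> \<open>Here \<open>i\<close> has to be dominated, but it is excluded and has no
          neighbour.\<close>
        have "dom_sets V E Z R = {}"
        proof (rule ccontr)
          assume "dom_sets V E Z R \<noteq> {}"
          then obtain S where S: "S \<in> dom_sets V E Z R" by blast
          then have "i \<in> S \<or> (\<exists>y\<in>S. (i, y) \<in> E)" using False iV by (auto simp: dom_sets_def)
          then show False using dom_sets_subset[OF S] i True by (auto simp: nbrs_def)
        qed
        then show ?thesis by simp
      next
        case nonempty: False
        then obtain j where j: "j \<in> nbrs V E i" by blast
        then have ij: "(i, j) \<in> E" "j \<in> V" by (auto simp: nbrs_def)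
        have "(i, j) \<in> (Restr E V)\<^sup>*" using ij iV by auto
        moreover have "i \<noteq> j" using ij edge_acyclic_irrefl[OF ac] by auto
        ultimately have jR: "j \<notin> R" using adm i by (auto simp: admissible_def)
        let ?E = "E - {(i, j), (j, i)}"
        \<comment> \<open>With both ends unchosen the edge dominates nothing and can be cut.\<close>
        have "{S \<in> dom_sets V E Z R. j \<notin> S} = dom_sets V ?E Z (insert j R)"
        proof (intro set_eqI)
          fix S
          show "S \<in> {S \<in> dom_sets V E Z R. j \<notin> S} \<longleftrightarrow> S \<in> dom_sets V ?E Z (insert j R)"
          proof (cases "S \<subseteq> V - R \<and> j \<notin> S")
            case True
            then have "(x, y) \<in> ?E \<longleftrightarrow> (x, y) \<in> E" if "y \<in> S" for x y using that i by auto
            then have "(\<exists>y\<in>S. (x, y) \<in> ?E) \<longleftrightarrow> (\<exists>y\<in>S. (x, y) \<in> E)" for x by blast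
            then show ?thesis using True by (auto simp: dom_sets_def)
          qed (auto simp: dom_sets_def)
        qed
        moreover have "excess (card V) (dom_sets V ?E Z (insert j R)) \<le> 0"
          by (intro IH_E ij admissible_cut_edge[OF adm i j])
        moreover have "excess (card V) {S \<in> dom_sets V E Z R. {j} \<subseteq> S} \<le> 0"
          using False ij jR j by (intro remove) auto
        moreover have "excess (card V) ({S \<in> dom_sets V E Z R. {j} \<subseteq> S} \<union> {S \<in> dom_sets V E Z R. j \<notin> S})
          = excess (card V) {S \<in> dom_sets V E Z R. {j} \<subseteq> S} + excess (card V) {S \<in> dom_sets V E Z R. j \<notin> S}"
          using fin by (intro excess_Un_disjoint) auto
        moreover have "{S \<in> dom_sets V E Z R. {j} \<subseteq> S} \<union> {S \<in> dom_sets V E Z R. j \<notin> S} = dom_sets V E Z R"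
          by blast
        ultimately show ?thesis by simp
      qed
    qed
  next
    case True
    note adm0 = adm[unfolded True]
    show ?thesis unfolding True
    proof (cases "\<exists>v\<in>V. card (leaves V E Z v) \<ge> 2")
      case True
      then obtain v where v: "v \<in> V" "card (leaves V E Z v) \<ge> 2" by blast
      show "excess (card V) (dom_sets V E Z {}) \<le> 0"
        by (rule excess_star_le(1)[OF adm0 v]) (use v in \<open>auto intro!: IH_V\<close>)
    next
      case no2: False
      have few: "card (leaves V E Z w) \<le> 1" for w
      proof (cases "w \<in> V")
        case True then show ?thesis using no2 by auto
      next
        case False
        then have "leaves V E Z w = {}" using leaf_edge[of _ V E Z w] by auto
        then show ?thesis by simp
      qed
      show "excess (card V) (dom_sets V E Z {}) \<le> 0"
      proof (cases "\<exists>u\<in>V. \<exists>v\<in>V. (u, v) \<in> E \<and> u \<notin> leaves V E Z v \<and> v \<notin> leaves V E Z u")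
        case True
        then obtain u v where uv: "(u, v) \<in> E" "u \<in> V" "v \<in> V" "u \<notin> leaves V E Z v" "v \<notin> leaves V E Z u"
          by blast
        have "excess (card V) (dom_sets V (E - {(u, v), (v, u)}) Z {}) \<le> 0"
          by (intro IH_E uv admissible_delete_edge[OF adm0])
        moreover have "card (leaves V E Z w) \<le> 2" for w using few[of w] by simp
        ultimately show ?thesis
          using excess_delete_edge[OF adm0 uv(1-3) _ IH_V] by fastforce
      next
        \<comment> \<open>Every edge now has a leaf end and no vertex has two leaves, so components
          are single edges or isolated free vertices.\<close>
        case no_edge: False
        show ?thesis
        proof (cases "V = {}")
          case True
          then have "dom_sets V E Z {} = {{}}" by (auto simp: dom_sets_def)
          then show ?thesis using True by (simp add: excess_def)
        next
          case False
          then obtain x where x: "x \<in> V" by blast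
          show ?thesis
          proof (cases "nbrs V E x = {}")
            case True
            then have xZ: "x \<in> Z" using adm0 x by (auto simp: admissible_def)
            have "nbrs (V - {x}) E y = nbrs V E y" if "y \<in> V" for y
              using True that symD[OF symE] by (auto simp: nbrs_def)
            then have "admissible (V - {x}) E Z {}" using adm0 by (auto simp: admissible_no_excluded_iff)
            then have "excess (card (V - {x})) (dom_sets (V - {x}) E Z {}) \<le> 0" using x by (intro IH_V) auto
            then show ?thesis
              using excess_remove_free_vertex(1)[OF fin(1) symE x xZ _ True, of "{}"] by simp
          next
            case False
            then obtain y where "y \<in> V" "(x, y) \<in> E" by (auto simp: nbrs_def)
            then have "x \<in> leaves V E Z y \<or> y \<in> leaves V E Z x" using no_edge x by blast
            then obtain l v where l: "l \<in> leaves V E Z v" and v: "v \<in> V" using x \<open>y \<in> V\<close> by blast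
            have lv: "(v, l) \<in> E" "l \<in> V" using leaf_edge[OF l] symD[OF symE, of l v] l by (auto simp: leaves_def)
            have J: "leaves V E Z v = {l}"
              using l few[of v] fin card_le_Suc0_iff_eq[of "leaves V E Z v"] by auto
            \<comment> \<open>Another edge at \<open>v\<close> would have a leaf end, either a
              second leaf at \<open>v\<close> or \<open>v\<close> itself, which is adjacent to
              \<open>l\<close> too.\<close>
            have "nbrs V E v = {l}"
            proof (rule ccontr)
              assume "nbrs V E v \<noteq> {l}"
              moreover have "l \<in> nbrs V E v" using lv by (auto simp: nbrs_def)
              ultimately obtain z where z: "z \<in> V" "(v, z) \<in> E" "z \<noteq> l" by (auto simp: nbrs_def)
              then have "v \<in> leaves V E Z z \<or> z \<in> leaves V E Z v" using no_edge v by blast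
              then show False using J z leaf_nbr_unique[of v V E Z z l] lv by auto
            qed
            then have dom_eq: "dom_sets (V - {v, l}) E (Z \<union> E `` {v}) {} = dom_sets (V - {v, l}) E Z {}"
              by (intro dom_sets_cong) (auto simp: nbrs_def)
            have "admissible (V - {v, l}) E Z {}" using admissible_remove_star(2)[OF adm0, of v] J by simp
            then have "excess (card (V - {v, l})) (dom_sets (V - {v, l}) E Z {}) \<le> 0"
              using v by (intro IH_V) auto
            \<comment> \<open>Both families in the star formula coincide; with excess
              \<open>e\<close> and size \<open>f\<close> it reads
              \<open>2 * (e + f / 2) + e - f = 3 * e\<close>.\<close>
            then show ?thesis using excess_star[OF fin(1) symE ac v, of Z] by (simp add: J dom_eq)
          qed
        qed
      qed
    qed
  qed
qed

section \<open>Vanishing excess\<close>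

text \<open>Some edge \<open>uv\<close> can be deleted, and a lost set exists, so the bound for edge
  deletion becomes strict.\<close>

lemma excess_neg_of_nonleaf_without_leaves:
  assumes adm: "admissible V E {} {}" and few: "\<And>w. card (leaves V E {} w) \<le> 2"
    and v: "v \<in> V" "leaves V E {} v = {}" "\<And>w. v \<notin> leaves V E {} w"
  shows "excess (card V) (dom_sets V E {} {}) < 0"
proof -
  have fin: "finite V" and symE: "sym E" and ac: "edge_acyclic E" using adm by (auto simp: admissible_def)
  obtain u where u: "u \<in> V" "(v, u) \<in> E" using adm v by (auto simp: admissible_def nbrs_def)
  then have uv: "(u, v) \<in> E" using symD[OF symE] by blast
  have no_triangle: "(x, y) \<notin> E \<or> (y, v) \<notin> E" if "(x, v) \<in> E" for x y
  proof (rule ccontr)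
    assume "\<not> ?thesis"
    then have "(x, y) \<in> E - {(x, v), (v, x)}" "(y, v) \<in> E - {(x, v), (v, x)}"
      using that edge_acyclic_irrefl[OF ac] by auto
    then have "(x, v) \<in> (E - {(x, v), (v, x)})\<^sup>*" by (meson converse_rtrancl_into_rtrancl r_into_rtrancl)
    then show False using ac that by (auto simp: edge_acyclic_def)
  qed
  let ?R = "insert v (nbrs V E v - {u})"
  \<comment> \<open>The witness omits \<open>v\<close> and all its neighbours but \<open>u\<close>.
    An omitted neighbour is no leaf at \<open>v\<close>, so it has another neighbour, which lies in
    the set because there are no triangles.\<close>
  have "V - ?R \<in> lost_sets V E {} u v"
  proof -
    have u_in: "u \<in> V - ?R" using u edge_acyclic_irrefl[OF ac] by auto
    have "x \<in> V - ?R \<or> (\<exists>y \<in> V - ?R. (x, y) \<in> E)" if x: "x \<in> V" for x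
    proof (cases "x \<in> ?R")
      case True
      show ?thesis
      proof (cases "x = v")
        case True
        then show ?thesis using u u_in by blast
      next
        case False
        then have xv: "(v, x) \<in> E" "(x, v) \<in> E" using \<open>x \<in> ?R\<close> symD[OF symE] by (auto simp: nbrs_def)
        have "nbrs V E x \<noteq> {v}" using v(2) x by (auto simp: leaves_def)
        moreover have "v \<in> nbrs V E x" using xv v(1) by (auto simp: nbrs_def)
        ultimately obtain y where y: "y \<in> V" "(x, y) \<in> E" "y \<noteq> v" by (auto simp: nbrs_def)
        then have "(v, y) \<notin> E" using no_triangle[OF xv(2), of y] symD[OF symE, of v y] by auto
        then show ?thesis using y by (auto simp: nbrs_def)
      qed
    qed (use x in auto)
    then show ?thesis using u_in by (auto simp: lost_sets_def dom_sets_def)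
  qed
  moreover have "finite (lost_sets V E {} u v)" using fin by (auto simp: lost_sets_def)
  ultimately have pos: "card (lost_sets V E {} u v) > 0" by (auto simp: card_gt_0_iff)
  have "u \<notin> leaves V E {} v" "v \<notin> leaves V E {} u" using v by auto
  then have "excess (card V) (dom_sets V (E - {(u, v), (v, u)}) {} {}) \<le> 0"
    by (intro excess_nonpos admissible_delete_edge[OF adm] uv u v)
  then show ?thesis
    using excess_delete_edge[OF adm uv u(1) v(1) few excess_nonpos] pos by simp
qed

text \<open>Stars are removed one at a time. \<open>Z\<close> is general because this frees the
  neighbours of the centre; those that remain keep their own leaves, so the hypothesis
  survives.\<close>

lemma excess_eq_0:
  assumes "finite V" "sym E" "edge_acyclic E"
    and "\<And>x. x \<in> V \<Longrightarrow> (\<exists>w. x \<in> leaves V E Z w) \<or> card (leaves V E Z x) \<in> {1, 2}"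
  shows "excess (card V) (dom_sets V E Z {}) = 0"
  using assms(1,4)
proof (induction "card V" arbitrary: V Z rule: less_induct)
  case less
  note fin = less.prems(1) and prem = less.prems(2)
  have symE: "(x, y) \<in> E \<Longrightarrow> (y, x) \<in> E" for x y using symD[OF assms(2)] .
  show ?case
  proof (cases "V = {}")
    case True
    then have "dom_sets V E Z {} = {{}}" by (auto simp: dom_sets_def)
    then show ?thesis using True by (simp add: excess_def)
  next
    case False
    then obtain x where x: "x \<in> V" by blast
    \<comment> \<open>If \<open>x\<close> is a leaf at \<open>w\<close> and \<open>w\<close> is a
      leaf too, they form a single edge and \<open>x\<close> is the one leaf at
      \<open>w\<close>.\<close>
    have "\<exists>v\<in>V. card (leaves V E Z v) \<in> {1, 2}"
    proof (cases "card (leaves V E Z x) \<in> {1, 2}")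
      case True then show ?thesis using x by blast
    next
      case False
      then obtain w where w: "x \<in> leaves V E Z w" using prem[OF x] by blast
      then have wV: "w \<in> V" "(w, x) \<in> E" using leaf_edge[OF w] symE by auto
      show ?thesis
      proof (cases "\<exists>z. w \<in> leaves V E Z z")
        case True
        then have "y = x" if "y \<in> leaves V E Z w" for y
          using leaf_edge[OF that] leaves_subset[of V E Z w] that leaf_nbr_unique wV symE x by (metis subsetD)
        then have "leaves V E Z w = {x}" using w by blast
        then show ?thesis using wV by (intro bexI[of _ w]) simp_all
      next
        case False
        then show ?thesis using prem[OF wV(1)] wV by blast
      qed
    qed
    then obtain v where v: "v \<in> V" and k: "card (leaves V E Z v) \<in> {1, 2}" by blast
    define J where "J = leaves V E Z v"
    define W where "W = V - insert v J"
    let ?Z = "Z \<union> E `` {v}"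
    have Jne: "J \<noteq> {}" using k by (auto simp: J_def)
    have J_nbr: "y = v" if "j \<in> J" "y \<in> V" "(j, y) \<in> E" for j y
      using leaf_nbr_unique[of j V E Z v y] that by (simp add: J_def)
    have J_edge: "j \<in> V" "(v, j) \<in> E" if "j \<in> J" for j
      using leaf_edge[of j V E Z v] leaves_subset[of V E Z v] that symE by (auto simp: J_def)
    \<comment> \<open>A vertex that loses \<open>v\<close> as neighbour becomes free and so never
      counts as a new leaf.\<close>
    have leaves_eq: "leaves W E ?Z x = leaves V E Z x" if xW: "x \<in> W" for x
    proof (intro equalityI subsetI)
      fix y assume y: "y \<in> leaves W E ?Z x"
      then have y': "y \<in> W - ?Z" "nbrs W E y = {x}" by (auto simp: leaves_def)
      have "nbrs V E y = nbrs W E y"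
        using y' J_nbr[of _ y] symE by (auto simp: nbrs_def W_def)
      then show "y \<in> leaves V E Z x" using y' by (auto simp: leaves_def W_def)
    next
      fix y assume y: "y \<in> leaves V E Z x"
      have only: "z = x" if "z \<in> V" "(y, z) \<in> E" for z using leaf_nbr_unique[OF y] that by blast
      have "y \<noteq> v" using only J_edge Jne xW by (auto simp: W_def)
      moreover have "y \<notin> J" using leaf_edge[OF y] J_nbr[of y x] xW by (auto simp: W_def)
      moreover have "(v, y) \<notin> E" using only[OF v] symE xW by (auto simp: W_def)
      ultimately have "y \<in> W - ?Z" using y by (auto simp: W_def leaves_def)
      moreover have "nbrs W E y = {x}" using only leaf_edge[OF y] xW unfolding nbrs_def W_def by blast
      ultimately show "y \<in> leaves W E ?Z x" by (auto simp: leaves_def)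
    qed
    have leaf_W: "w \<in> W" if "x \<in> W" "x \<in> leaves V E Z w" for x w
      using leaf_edge[OF that(2)] that J_nbr[of w x] symE by (auto simp: W_def J_def)
    have "(\<exists>w. x \<in> leaves W E ?Z w) \<or> card (leaves W E ?Z x) \<in> {1, 2}" if "x \<in> W" for x
      using prem[of x] that leaves_eq leaf_W by (metis DiffD1 W_def)
    moreover have "card W < card V" using fin v by (intro psubset_card_mono) (auto simp: W_def)
    ultimately have IH: "excess (card W) (dom_sets W E ?Z {}) = 0"
      using less.hyps[of W ?Z] fin by (auto simp: W_def)
    \<comment> \<open>A non-free neighbour \<open>x\<close> of \<open>v\<close> in \<open>W\<close>
      has a leaf of its own; dominating that leaf requires choosing it or \<open>x\<close>, and
      either dominates \<open>x\<close>.\<close>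
    have "dom_sets W E ?Z {} \<subseteq> dom_sets W E Z {}"
    proof
      fix S assume S: "S \<in> dom_sets W E ?Z {}"
      have "x \<in> S \<or> (\<exists>y\<in>S. (x, y) \<in> E)" if x: "x \<in> W - Z" for x
      proof (cases "x \<in> ?Z")
        case False
        then show ?thesis using S x by (auto simp: dom_sets_def)
      next
        case True
        then have vx: "(x, v) \<in> E" using x symE by auto
        have "x \<notin> leaves V E Z w" for w
          using leaf_nbr_unique[of x V E Z w v] v vx x by (auto simp: W_def J_def)
        then have "card (leaves V E Z x) \<in> {1, 2}" using prem[of x] x by (auto simp: W_def)
        then have "leaves W E ?Z x \<noteq> {}" using leaves_eq x by auto
        then obtain y where y: "y \<in> leaves W E ?Z x" by blast
        then have "y \<in> S \<or> (\<exists>z\<in>S. (y, z) \<in> E)" using S by (auto simp: dom_sets_def leaves_def)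
        then show ?thesis
          using leaf_edge[OF y] leaf_nbr_unique[OF y] dom_sets_subset[OF S] symE by blast
      qed
      then show "S \<in> dom_sets W E Z {}" using dom_sets_subset[OF S] by (auto simp: dom_sets_def)
    qed
    then have "dom_sets W E ?Z {} = dom_sets W E Z {}" using dom_sets_mono[of Z ?Z W E "{}"] by blast
    \<comment> \<open>With equal families of excess \<open>e\<close> the star formula gives
      \<open>3 * e\<close> for one leaf and \<open>5 * e\<close> for two.\<close>
    then show ?thesis
      using excess_star[OF fin assms(2,3) v, of Z] Jne k IH unfolding J_def[symmetric] W_def[symmetric]
      by auto
  qed
qed

lemma excess_eq_0_iff:
  assumes adm: "admissible V E {} {}"
  shows "excess (card V) (dom_sets V E {} {}) = 0 \<longleftrightarrow>
    (\<forall>v\<in>V. (\<forall>w. v \<notin> leaves V E {} w) \<longrightarrow> card (leaves V E {} v) \<in> {1, 2})"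
    (is "?L \<longleftrightarrow> ?R")
proof
  assume ?R
  then show ?L using adm by (intro excess_eq_0) (auto simp: admissible_def)
next
  assume eq: ?L
  have le2: "card (leaves V E {} v) \<le> 2" for v
  proof (rule ccontr)
    assume "\<not> ?thesis"
    then have ge3: "card (leaves V E {} v) \<ge> 3" by simp
    then have "leaves V E {} v \<noteq> {}" by auto
    then have "v \<in> V" using leaf_edge[of _ V E "{}" v] by blast
    then show False using excess_star_le(2)[OF adm _ _ excess_nonpos ge3] ge3 eq by simp
  qed
  show ?R
  proof (intro ballI impI)
    fix v assume v: "v \<in> V" "\<forall>w. v \<notin> leaves V E {} w"
    then have "leaves V E {} v \<noteq> {}"
      using excess_neg_of_nonleaf_without_leaves[OF adm le2 v(1)] eq by auto
    moreover have "finite (leaves V E {} v)" using adm by (auto simp: admissible_def)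
    ultimately have "card (leaves V E {} v) \<noteq> 0" by simp
    then show "card (leaves V E {} v) \<in> {1, 2}" using le2[of v] by auto
  qed
qed

section \<open>Average order of dominating sets of forests\<close>

text \<open>A simple path from \<open>u\<close> to \<open>v\<close> avoiding the edge is closed to a
  directed cycle by the arc \<open>(v, u)\<close>.\<close>

lemma undirected_forest_edge_acyclic:
  assumes "undirected_forest G"
  shows "edge_acyclic (parcs G)"
  unfolding edge_acyclic_def
proof (intro allI impI notI)
  fix u v
  assume uv: "(u, v) \<in> parcs G" and conn: "(u, v) \<in> (parcs G - {(u, v), (v, u)})\<^sup>*"
  interpret G: pair_graph G using assms by (simp add: undirected_forest_def)
  define H where "H = \<lparr>pverts = pverts G, parcs = parcs G - {(u, v), (v, u)}\<rparr>"
  interpret H: pair_wf_digraph H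
    by unfold_locales (auto simp: H_def dest: G.in_arcsD1 G.in_arcsD2)
  have "u \<rightarrow>\<^sup>*\<^bsub>with_proj H\<^esub> v"
    using conn G.in_arcsD1[OF uv] G.in_arcsD2[OF uv] by (simp add: H.reachable_conv) (simp add: H_def)
  then obtain p where p: "H.apath u p v" using H.reachable_apath by blast
  then have walk: "set p \<subseteq> parcs G - {(u, v), (v, u)}" "pcas u p v" "distinct (pawalk_verts u p)"
    unfolding H.apath_def H.awalk_def by (auto simp: H_def)
  have "(v, u) \<in> parcs G" using uv by (rule G.arcs_symmetric)
  then have "G.cycle ((v, u) # p)"
    unfolding G.cycle_def G.awalk_def using walk G.in_arcsD2[OF uv]
    by (intro exI[of _ v]) auto
  \<comment> \<open>An empty path would make the edge a loop, and a path of one arc would be the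
    removed arc \<open>(u, v)\<close>.\<close>
  moreover have "2 \<le> length p"
  proof (rule ccontr)
    assume "\<not> 2 \<le> length p"
    then consider "p = []" | e where "p = [e]"
      by (cases p; cases "tl p") auto
    then show False
    proof cases
      case 1
      then show False using walk G.no_loops'[OF uv] by simp
    next
      case 2
      then show False using walk by (cases e) auto
    qed
  qed
  ultimately show False using assms by (auto simp: undirected_forest_def)
qed

lemma leaf_iff_nbrs:
  assumes "pair_graph G"
  shows "leaf G v \<longleftrightarrow> v \<in> pverts G \<and> (\<exists>w. nbrs (pverts G) (parcs G) v = {w})"
    and "isolated_vertex G v \<longleftrightarrow> v \<in> pverts G \<and> nbrs (pverts G) (parcs G) v = {}"
proof -
  interpret pair_graph G by fact
  have "out_arcs (with_proj G) v = Pair v ` nbrs (pverts G) (parcs G) v"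
    by (auto simp: out_arcs_def nbrs_def dest: in_arcsD2)
  then have "out_degree (with_proj G) v = card (nbrs (pverts G) (parcs G) v)"
    by (simp add: out_degree_def card_image inj_on_def)
  moreover have "finite (nbrs (pverts G) (parcs G) v)"
    using pair_finite_verts nbrs_subset by (rule finite_subset[rotated])
  ultimately show "leaf G v \<longleftrightarrow> v \<in> pverts G \<and> (\<exists>w. nbrs (pverts G) (parcs G) v = {w})"
    and "isolated_vertex G v \<longleftrightarrow> v \<in> pverts G \<and> nbrs (pverts G) (parcs G) v = {}"
    by (auto simp: leaf_def isolated_vertex_def card_1_singleton_iff)
qed

lemma leaf_neighbors_eq_leaves:
  assumes "pair_graph G"
  shows "leaf_neighbors G v = leaves (pverts G) (parcs G) {} v"
proof -
  interpret pair_graph G by fact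
  let ?N = "nbrs (pverts G) (parcs G)"
  have "(\<exists>w. ?N x = {w}) \<and> (v, x) \<in> parcs G \<longleftrightarrow> ?N x = {v}" for x
  proof -
    have "v \<in> ?N x \<longleftrightarrow> (v, x) \<in> parcs G"
      using arcs_symmetric in_arcsD1 by (auto simp: nbrs_def)
    then show ?thesis by auto
  qed
  then show ?thesis
    unfolding leaf_neighbors_def leaves_def leaf_iff_nbrs(1)[OF assms] by blast
qed

text \<open>The excess equals \<open>(3 * avd G - 2 * card (pverts G)) * card D\<close>, where
  \<open>card D\<close> is positive since the whole vertex set dominates.\<close>

lemma avd_excess:
  assumes "finite (pverts G)"
  defines "D \<equiv> dom_sets (pverts G) (parcs G) {} {}"
  shows "avd G \<le> 2 * real (card (pverts G)) / 3 \<longleftrightarrow> excess (card (pverts G)) D \<le> 0"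
    and "avd G = 2 * real (card (pverts G)) / 3 \<longleftrightarrow> excess (card (pverts G)) D = 0"
proof -
  have D: "{S. dominating_set G S} = D"
    unfolding D_def dom_sets_def dominating_set_def by auto
  have "pverts G \<in> D" by (auto simp: D_def dom_sets_def)
  then have pos: "card D > 0" using assms(1) by (auto simp: D_def card_gt_0_iff)
  have "excess (card (pverts G)) D = 3 * (\<Sum>S\<in>D. real (card S)) - 2 * real (card (pverts G)) * real (card D)"
    by (simp add: excess_def sum_subtractf sum_distrib_left)
  also have "(\<Sum>S\<in>D. real (card S)) = avd G * real (card D)"
    using pos by (simp add: avd_def D)
  finally have eq: "excess (card (pverts G)) D = (3 * avd G - 2 * real (card (pverts G))) * real (card D)"
    by (simp add: algebra_simps)
  show "avd G \<le> 2 * real (card (pverts G)) / 3 \<longleftrightarrow> excess (card (pverts G)) D \<le> 0"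
    unfolding eq using pos by (auto simp: mult_le_0_iff)
  show "avd G = 2 * real (card (pverts G)) / 3 \<longleftrightarrow> excess (card (pverts G)) D = 0"
    unfolding eq using pos by auto
qed

theorem theorem3p4:
  fixes G :: "'a pair_pre_digraph" and n :: nat
  assumes "undirected_forest G"
    and "card (pverts G) = n"
    and "\<forall>v \<in> pverts G. \<not> isolated_vertex G v"
  shows "avd G \<le> 2 * real n / 3 \<and>
    (avd G = 2 * real n / 3 \<longleftrightarrow>
      (\<forall>v \<in> pverts G. \<not> leaf G v \<longrightarrow>
         support_vertex G v \<and> card (leaf_neighbors G v) \<in> {1, 2}))"
proof -
  have graph: "pair_graph G" using assms(1) by (simp add: undirected_forest_def)
  interpret pair_graph G by (rule graph)
  let ?V = "pverts G" and ?E = "parcs G"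
  have "sym ?E" using arcs_symmetric by (auto simp: sym_def)
  then have adm: "admissible ?V ?E {} {}"
    using assms(3) pair_finite_verts pair_finite_arcs undirected_forest_edge_acyclic[OF assms(1)]
    by (auto simp: admissible_no_excluded_iff leaf_iff_nbrs(2)[OF graph])
  have leaf: "leaf G v \<longleftrightarrow> (\<exists>w. v \<in> leaves ?V ?E {} w)" for v
    by (auto simp: leaves_def leaf_iff_nbrs(1)[OF graph])
  have "support_vertex G v" if "v \<in> ?V" "card (leaf_neighbors G v) \<in> {1, 2}" for v
  proof -
    have "leaf_neighbors G v \<noteq> {}" using that(2) by auto
    then show ?thesis using that(1) by (auto simp: support_vertex_def leaf_neighbors_def)
  qed
  then have "(\<forall>v \<in> ?V. \<not> leaf G v \<longrightarrow> support_vertex G v \<and> card (leaf_neighbors G v) \<in> {1, 2})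
    \<longleftrightarrow> (\<forall>v \<in> ?V. (\<forall>w. v \<notin> leaves ?V ?E {} w) \<longrightarrow> card (leaves ?V ?E {} v) \<in> {1, 2})"
    unfolding leaf leaf_neighbors_eq_leaves[OF graph] by blast
  then show ?thesis
    unfolding assms(2)[symmetric] avd_excess[OF pair_finite_verts]
    using excess_nonpos[OF adm] excess_eq_0_iff[OF adm] by simp
qed

end
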